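(* Let $X$ be a set and $R\subseteq X\times X$. Then $$R^*=\mathrm{cl}\,R\qquad\text{and}\qquad -((-R)^* )=\mathrm{int}(\mathrm{cl}\,R),$$ where $\mathrm{cl}$ and $\mathrm{int}$ are the closure and interior operations of $\beta X\times\beta X$.
   Context: $\beta X$ denotes the set of ultrafilters over $X$, with the topology generated by the sets $\{u\in\beta X:S\in u\}$ for $S\subseteq X$; $\beta X\times\beta X$ has the product topology. $X$ is identified with the set of principal ultrafilters in $\beta X$, so $R\subseteq X\times X\subseteq\beta X\times\beta X$. For $R\subseteq X\times X$ and $u,v\in\beta X$, $$R^*(u,v)\iff(\forall S\in v)\ \{x:(\exists y\in S)\,R(x,y)\}\in u.$$ The sign $-$ denotes complement: $-R=(X\times X)\setminus R$, and $-Q=(\beta X\times\beta X)\setminus Q$ for a relation $Q$ on $\beta X$; thus $-((-R)^* )=(\beta X\times\beta X)\setminus((X\times X)\setminus R)^*$. *)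

theory Defs
  imports "HOL-Analysis.Product_Topology"
begin

definition ultrafilter_on :: "'a set \<Rightarrow> 'a set set \<Rightarrow> bool" where
  "ultrafilter_on X u \<longleftrightarrow>
     u \<subseteq> Pow X \<and> X \<in> u \<and> {} \<notin> u \<and>
     (\<forall>A\<in>u. \<forall>B\<in>u. A \<inter> B \<in> u) \<and>
     (\<forall>A\<in>u. \<forall>B. A \<subseteq> B \<and> B \<subseteq> X \<longrightarrow> B \<in> u) \<and>
     (\<forall>A. A \<subseteq> X \<longrightarrow> A \<in> u \<or> X - A \<in> u)"

definition ultrafilters :: "'a set \<Rightarrow> 'a set set set" where
  "ultrafilters X = {u. ultrafilter_on X u}"

definition beta_topology :: "'a set \<Rightarrow> 'a set set topology" where
  "beta_topology X =
     topology_generated_by {{u \<in> ultrafilters X. S \<in> u} | S. S \<subseteq> X}"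

definition principal_uf :: "'a set \<Rightarrow> 'a \<Rightarrow> 'a set set" where
  "principal_uf X x = {S. S \<subseteq> X \<and> x \<in> S}"

(* The identification of X with the principal ultrafilters is made explicit:
   a relation on X becomes a relation on ultrafilters as its image under this embedding. *)
definition embed_rel :: "'a set \<Rightarrow> ('a \<times> 'a) set \<Rightarrow> ('a set set \<times> 'a set set) set" where
  "embed_rel X R = map_prod (principal_uf X) (principal_uf X) ` R"

definition star_ext :: "'a set \<Rightarrow> ('a \<times> 'a) set \<Rightarrow> ('a set set \<times> 'a set set) set" where
  "star_ext X R = {(u, v) \<in> ultrafilters X \<times> ultrafilters X.
     \<forall>S\<in>v. {x \<in> X. \<exists>y\<in>S. (x, y) \<in> R} \<in> u}"

end

theory Submission
  imports Defs
begin

text \<open>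
  The products of two sets \<open>basic_clopen X A\<close> and \<open>basic_clopen X B\<close> with \<open>A \<in> u\<close> and \<open>B \<in> v\<close>
  form a neighbourhood base at a point \<open>(u, v)\<close> of the square of the ultrafilter space. So both
  sides of both equations can be compared in terms of rectangles in \<open>X \<times> X\<close>.

  The point \<open>(u, v)\<close> is in the closure of \<open>R\<close> iff \<open>R\<close> meets \<open>A \<times> B\<close> for all \<open>A \<in> u\<close> and \<open>B \<in> v\<close>.
  Since \<open>u\<close> is an ultrafilter, a subset of \<open>X\<close> belongs to \<open>u\<close> iff it meets every member of \<open>u\<close>
  (lemma \<open>ultrafilter_mem_iff_meets\<close>); applied to the sets of \<open>R\<close>-predecessors of the members of \<open>v\<close>, this
  says that \<open>(u, v)\<close> is in the extension of \<open>R\<close> (lemmas \<open>star_ext_iff\<close> and \<open>closure_embed_rel_iff\<close>).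

  Negating this for the complement of \<open>R\<close>, the point \<open>(u, v)\<close> is outside the extension of the
  complement iff \<open>A \<times> B \<subseteq> R\<close> for some \<open>A \<in> u\<close> and \<open>B \<in> v\<close>. It is in the interior of the closure
  of \<open>R\<close> iff a basic rectangle around it is contained in that closure. The two conditions agree
  because the basic rectangle given by \<open>A\<close> and \<open>B\<close> is contained in the closure of \<open>R\<close> iff
  \<open>A \<times> B \<subseteq> R\<close> (lemma \<open>basic_rectangle_subset_star_ext_iff\<close>): ultrafilters are closed under
  intersection, and principal ultrafilters are isolated points.
\<close>

section \<open>Ultrafilters\<close>

text \<open>
  The ultrafilters on \<open>X\<close> that contain \<open>S\<close>. For \<open>S \<subseteq> X\<close> this is a generator of the topology; it is
  also closed, since its complement is the set given by \<open>X - S\<close>.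
\<close>

definition basic_clopen :: "'a set \<Rightarrow> 'a set \<Rightarrow> 'a set set set" where
  "basic_clopen X S = {u \<in> ultrafilters X. S \<in> u}"

lemma in_basic_clopen_iff: "u \<in> basic_clopen X S \<longleftrightarrow> u \<in> ultrafilters X \<and> S \<in> u"
  by (simp add: basic_clopen_def)

lemma ultrafilter_subset: "u \<in> ultrafilters X \<Longrightarrow> A \<in> u \<Longrightarrow> A \<subseteq> X"
  unfolding ultrafilters_def ultrafilter_on_def by blast

lemma ultrafilter_space_mem: "u \<in> ultrafilters X \<Longrightarrow> X \<in> u"
  unfolding ultrafilters_def ultrafilter_on_def by blast

lemma ultrafilter_Int: "u \<in> ultrafilters X \<Longrightarrow> A \<in> u \<Longrightarrow> B \<in> u \<Longrightarrow> A \<inter> B \<in> u"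
  unfolding ultrafilters_def ultrafilter_on_def by blast

lemma ultrafilter_nonempty: "u \<in> ultrafilters X \<Longrightarrow> A \<in> u \<Longrightarrow> A \<noteq> {}"
  unfolding ultrafilters_def ultrafilter_on_def by blast

lemma ultrafilter_upward:
  "u \<in> ultrafilters X \<Longrightarrow> A \<in> u \<Longrightarrow> A \<subseteq> B \<Longrightarrow> B \<subseteq> X \<Longrightarrow> B \<in> u"
  unfolding ultrafilters_def ultrafilter_on_def by blast

lemma ultrafilter_mem_iff_meets:
  assumes u: "u \<in> ultrafilters X" and "T \<subseteq> X"
  shows "T \<in> u \<longleftrightarrow> (\<forall>A\<in>u. A \<inter> T \<noteq> {})"
proof
  assume "T \<in> u"
  then show "\<forall>A\<in>u. A \<inter> T \<noteq> {}"
    using ultrafilter_Int[OF u] ultrafilter_nonempty[OF u] by blast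
next
  assume meets: "\<forall>A\<in>u. A \<inter> T \<noteq> {}"
  have "T \<in> u \<or> X - T \<in> u"
    using u \<open>T \<subseteq> X\<close> unfolding ultrafilters_def ultrafilter_on_def by blast
  then show "T \<in> u"
    using meets by blast
qed

lemma principal_uf_mem_iff: "A \<in> principal_uf X x \<longleftrightarrow> A \<subseteq> X \<and> x \<in> A"
  by (simp add: principal_uf_def)

lemma principal_uf_ultrafilter: "x \<in> X \<Longrightarrow> principal_uf X x \<in> ultrafilters X"
  unfolding ultrafilters_def ultrafilter_on_def principal_uf_def by auto

lemma basic_clopen_Int_subset:
  assumes "A \<subseteq> X" "B \<subseteq> X"
  shows "basic_clopen X (A \<inter> B) \<subseteq> basic_clopen X A \<inter> basic_clopen X B"
proof
  fix u assume u: "u \<in> basic_clopen X (A \<inter> B)"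
  then have "A \<in> u" "B \<in> u"
    using assms ultrafilter_upward[of u X "A \<inter> B"] by (auto simp: in_basic_clopen_iff)
  then show "u \<in> basic_clopen X A \<inter> basic_clopen X B"
    using u by (auto simp: in_basic_clopen_iff)
qed

section \<open>Neighbourhood bases in the ultrafilter space and its square\<close>

lemma topspace_beta_topology: "topspace (beta_topology X) = ultrafilters X"
  unfolding beta_topology_def topology_generated_by_topspace
  using ultrafilter_space_mem by auto

lemma openin_basic_clopen: "S \<subseteq> X \<Longrightarrow> openin (beta_topology X) (basic_clopen X S)"
  unfolding beta_topology_def basic_clopen_def
  by (rule topology_generated_by_Basis) auto

text \<open>
  The generators are a base and not only a subbase, because ultrafilters are closed under
  intersection.
\<close>

lemma openin_beta_topology_basic:
  assumes "openin (beta_topology X) U" "u \<in> U"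
  obtains S where "S \<in> u" "basic_clopen X S \<subseteq> U"
proof -
  have uX: "u \<in> ultrafilters X"
    using assms openin_subset topspace_beta_topology by blast
  have "generate_topology_on {{u \<in> ultrafilters X. S \<in> u} | S. S \<subseteq> X} U"
    using assms(1) unfolding beta_topology_def by (rule openin_topology_generated_by)
  then have "u \<in> U \<longrightarrow> (\<exists>S\<in>u. basic_clopen X S \<subseteq> U)"
  proof induction
    case Empty
    then show ?case by simp
  next
    case (Int U V)
    show ?case
    proof
      assume "u \<in> U \<inter> V"
      then obtain S T where ST: "S \<in> u" "T \<in> u" "basic_clopen X S \<subseteq> U" "basic_clopen X T \<subseteq> V"
        using Int by blast
      then have "basic_clopen X (S \<inter> T) \<subseteq> U \<inter> V"
        using basic_clopen_Int_subset[of S X T] ultrafilter_subset[OF uX] by blast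
      then show "\<exists>S\<in>u. basic_clopen X S \<subseteq> U \<inter> V"
        using ultrafilter_Int[OF uX] ST by blast
    qed
  next
    case (UN K)
    then show ?case by (meson Union_iff Union_upper order_trans)
  next
    case (Basis s)
    then show ?case unfolding basic_clopen_def by auto
  qed
  then show thesis
    using assms(2) that by blast
qed

lemma openin_basic_rectangle:
  assumes "A \<subseteq> X" "B \<subseteq> X"
  shows "openin (prod_topology (beta_topology X) (beta_topology X))
           (basic_clopen X A \<times> basic_clopen X B)"
  using assms by (simp add: openin_prod_Times_iff openin_basic_clopen)

lemma openin_beta_square_basic:
  assumes "openin (prod_topology (beta_topology X) (beta_topology X)) W" "(u, v) \<in> W"
  obtains A B where "A \<in> u" "B \<in> v" "basic_clopen X A \<times> basic_clopen X B \<subseteq> W"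
proof -
  obtain U V where UV: "openin (beta_topology X) U" "openin (beta_topology X) V"
      "u \<in> U" "v \<in> V" "U \<times> V \<subseteq> W"
    using openin_prod_topology_alt[THEN iffD1, rule_format, OF assms] by blast
  obtain A where "A \<in> u" "basic_clopen X A \<subseteq> U"
    by (rule openin_beta_topology_basic[OF UV(1,3)])
  moreover obtain B where "B \<in> v" "basic_clopen X B \<subseteq> V"
    by (rule openin_beta_topology_basic[OF UV(2,4)])
  ultimately show thesis
    using that[of A B] UV(5) by blast
qed

section \<open>The extension of a relation is its closure\<close>

lemma star_ext_subset: "star_ext X R \<subseteq> ultrafilters X \<times> ultrafilters X"
  unfolding star_ext_def by blast

lemma star_ext_iff:
  assumes u: "u \<in> ultrafilters X" and v: "v \<in> ultrafilters X"
  shows "(u, v) \<in> star_ext X R \<longleftrightarrow> (\<forall>A\<in>u. \<forall>B\<in>v. R \<inter> A \<times> B \<noteq> {})"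
proof -
  have "{x \<in> X. \<exists>y\<in>B. (x, y) \<in> R} \<in> u \<longleftrightarrow> (\<forall>A\<in>u. R \<inter> A \<times> B \<noteq> {})" for B
  proof -
    have "A \<inter> {x \<in> X. \<exists>y\<in>B. (x, y) \<in> R} \<noteq> {} \<longleftrightarrow> R \<inter> A \<times> B \<noteq> {}" if "A \<in> u" for A
      using ultrafilter_subset[OF u that] by blast
    then show ?thesis
      using ultrafilter_mem_iff_meets[OF u, of "{x \<in> X. \<exists>y\<in>B. (x, y) \<in> R}"] by blast
  qed
  then show ?thesis
    using u v unfolding star_ext_def by blast
qed

lemma embed_rel_meets_basic_rectangle_iff:
  assumes "R \<subseteq> X \<times> X" "A \<subseteq> X" "B \<subseteq> X"
  shows "embed_rel X R \<inter> basic_clopen X A \<times> basic_clopen X B \<noteq> {} \<longleftrightarrow> R \<inter> A \<times> B \<noteq> {}"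
proof
  assume "embed_rel X R \<inter> basic_clopen X A \<times> basic_clopen X B \<noteq> {}"
  then show "R \<inter> A \<times> B \<noteq> {}"
    by (auto simp: embed_rel_def in_basic_clopen_iff principal_uf_mem_iff)
next
  assume "R \<inter> A \<times> B \<noteq> {}"
  then obtain x y where xy: "(x, y) \<in> R" "x \<in> A" "y \<in> B"
    by blast
  then have "(principal_uf X x, principal_uf X y) \<in> embed_rel X R"
    unfolding embed_rel_def by force
  moreover have "principal_uf X x \<in> basic_clopen X A" "principal_uf X y \<in> basic_clopen X B"
    using xy assms
    by (auto simp: in_basic_clopen_iff principal_uf_mem_iff intro!: principal_uf_ultrafilter)
  ultimately show "embed_rel X R \<inter> basic_clopen X A \<times> basic_clopen X B \<noteq> {}"
    by blast
qed

lemma closure_embed_rel_iff: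
  assumes R: "R \<subseteq> X \<times> X" and u: "u \<in> ultrafilters X" and v: "v \<in> ultrafilters X"
  shows "(u, v) \<in> prod_topology (beta_topology X) (beta_topology X) closure_of embed_rel X R
           \<longleftrightarrow> (\<forall>A\<in>u. \<forall>B\<in>v. R \<inter> A \<times> B \<noteq> {})"
    (is "(u, v) \<in> ?T closure_of _ \<longleftrightarrow> ?meets")
proof
  assume cl: "(u, v) \<in> ?T closure_of embed_rel X R"
  show ?meets
  proof (intro ballI)
    fix A B assume AB: "A \<in> u" "B \<in> v"
    then have sub: "A \<subseteq> X" "B \<subseteq> X"
      using u v ultrafilter_subset by blast+
    have "(u, v) \<in> basic_clopen X A \<times> basic_clopen X B"
      using AB u v by (simp add: in_basic_clopen_iff)
    then have "\<exists>p. p \<in> embed_rel X R \<and> p \<in> basic_clopen X A \<times> basic_clopen X B"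
      using cl openin_basic_rectangle[OF sub] unfolding in_closure_of by metis
    then show "R \<inter> A \<times> B \<noteq> {}"
      using embed_rel_meets_basic_rectangle_iff[OF R sub] by blast
  qed
next
  assume meets: ?meets
  show "(u, v) \<in> ?T closure_of embed_rel X R"
    unfolding in_closure_of
  proof (intro conjI allI impI)
    show "(u, v) \<in> topspace ?T"
      using u v by (simp add: topspace_beta_topology)
  next
    fix W assume "(u, v) \<in> W \<and> openin ?T W"
    then have W: "openin ?T W" "(u, v) \<in> W"
      by simp_all
    obtain A B where AB: "A \<in> u" "B \<in> v" "basic_clopen X A \<times> basic_clopen X B \<subseteq> W"
      by (rule openin_beta_square_basic[OF W])
    then have "A \<subseteq> X" "B \<subseteq> X"
      using u v ultrafilter_subset by blast+
    then have "embed_rel X R \<inter> basic_clopen X A \<times> basic_clopen X B \<noteq> {}"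
      using embed_rel_meets_basic_rectangle_iff[OF R] meets AB(1,2) by simp
    then show "\<exists>y. y \<in> embed_rel X R \<and> y \<in> W"
      using AB(3) by blast
  qed
qed

lemma star_ext_eq_closure:
  assumes "R \<subseteq> X \<times> X"
  shows "star_ext X R
           = prod_topology (beta_topology X) (beta_topology X) closure_of embed_rel X R"
    (is "_ = ?T closure_of _")
proof -
  have "?T closure_of embed_rel X R \<subseteq> ultrafilters X \<times> ultrafilters X"
    using closure_of_subset_topspace[of ?T] by (simp add: topspace_beta_topology)
  moreover have "(u, v) \<in> star_ext X R \<longleftrightarrow> (u, v) \<in> ?T closure_of embed_rel X R"
    if "u \<in> ultrafilters X" "v \<in> ultrafilters X" for u v
    unfolding star_ext_iff[OF that] closure_embed_rel_iff[OF assms that] ..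
  ultimately show ?thesis
    using star_ext_subset[of X R] by (intro equalityI subrelI) blast+
qed

section \<open>The interior of the closure\<close>

lemma not_star_ext_complement_iff:
  assumes u: "u \<in> ultrafilters X" and v: "v \<in> ultrafilters X"
  shows "(u, v) \<notin> star_ext X (X \<times> X - R) \<longleftrightarrow> (\<exists>A\<in>u. \<exists>B\<in>v. A \<times> B \<subseteq> R)"
proof -
  have "(X \<times> X - R) \<inter> A \<times> B = {} \<longleftrightarrow> A \<times> B \<subseteq> R" if "A \<in> u" "B \<in> v" for A B
    using ultrafilter_subset[OF u that(1)] ultrafilter_subset[OF v that(2)] by blast
  then show ?thesis
    unfolding star_ext_iff[OF u v] by (simp cong: bex_cong)
qed

lemma basic_rectangle_subset_star_ext_iff:
  assumes "A \<subseteq> X" "B \<subseteq> X"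
  shows "basic_clopen X A \<times> basic_clopen X B \<subseteq> star_ext X R \<longleftrightarrow> A \<times> B \<subseteq> R"
proof
  assume sub: "basic_clopen X A \<times> basic_clopen X B \<subseteq> star_ext X R"
  show "A \<times> B \<subseteq> R"
  proof clarify
    fix a b assume ab: "a \<in> A" "b \<in> B"
    then have uf: "principal_uf X a \<in> ultrafilters X" "principal_uf X b \<in> ultrafilters X"
      using assms by (auto intro!: principal_uf_ultrafilter)
    have "principal_uf X a \<in> basic_clopen X A" "principal_uf X b \<in> basic_clopen X B"
      using uf ab assms by (simp_all add: in_basic_clopen_iff principal_uf_mem_iff)
    then have "(principal_uf X a, principal_uf X b) \<in> star_ext X R"
      using sub by blast
    \<comment> \<open>The singletons isolate the principal ultrafilters, so \<open>R\<close> must contain the point itself.\<close>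
    moreover have "{a} \<in> principal_uf X a" "{b} \<in> principal_uf X b"
      using ab assms by (auto simp: principal_uf_mem_iff)
    ultimately have "R \<inter> {a} \<times> {b} \<noteq> {}"
      using star_ext_iff[OF uf] by metis
    then show "(a, b) \<in> R"
      by blast
  qed
next
  assume sub: "A \<times> B \<subseteq> R"
  show "basic_clopen X A \<times> basic_clopen X B \<subseteq> star_ext X R"
  proof clarify
    fix u v assume "u \<in> basic_clopen X A" "v \<in> basic_clopen X B"
    then have u: "u \<in> ultrafilters X" "A \<in> u" and v: "v \<in> ultrafilters X" "B \<in> v"
      by (simp_all add: in_basic_clopen_iff)
    have "R \<inter> A' \<times> B' \<noteq> {}" if "A' \<in> u" "B' \<in> v" for A' B'
    proof -
      have "A \<inter> A' \<noteq> {}" "B \<inter> B' \<noteq> {}"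
        using that ultrafilter_nonempty[OF u(1) ultrafilter_Int[OF u]]
          ultrafilter_nonempty[OF v(1) ultrafilter_Int[OF v]] by blast+
      then show ?thesis
        using sub by blast
    qed
    then show "(u, v) \<in> star_ext X R"
      using star_ext_iff[OF u(1) v(1)] by simp
  qed
qed

lemma complement_star_ext_complement_eq_interior:
  "ultrafilters X \<times> ultrafilters X - star_ext X (X \<times> X - R)
     = prod_topology (beta_topology X) (beta_topology X) interior_of star_ext X R"
    (is "?L = ?T interior_of _")
proof (intro equalityI subsetI)
  fix p assume "p \<in> ?L"
  then obtain u v where p: "p = (u, v)" and u: "u \<in> ultrafilters X" and v: "v \<in> ultrafilters X"
      and "(u, v) \<notin> star_ext X (X \<times> X - R)"
    by blast
  then obtain A B where AB: "A \<in> u" "B \<in> v" "A \<times> B \<subseteq> R"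
    using not_star_ext_complement_iff[OF u v] by metis
  then have sub: "A \<subseteq> X" "B \<subseteq> X"
    using u v ultrafilter_subset by blast+
  have mem: "p \<in> basic_clopen X A \<times> basic_clopen X B"
    using p u v AB by (simp add: in_basic_clopen_iff)
  have "basic_clopen X A \<times> basic_clopen X B \<subseteq> star_ext X R"
    using basic_rectangle_subset_star_ext_iff[OF sub] AB(3) by simp
  then have "basic_clopen X A \<times> basic_clopen X B \<subseteq> ?T interior_of star_ext X R"
    by (rule interior_of_maximal[OF _ openin_basic_rectangle[OF sub]])
  then show "p \<in> ?T interior_of star_ext X R"
    using mem by (rule subsetD)
next
  fix p assume "p \<in> ?T interior_of star_ext X R"
  then obtain W where W: "openin ?T W" "p \<in> W" "W \<subseteq> star_ext X R"
    by (auto simp: interior_of_def)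
  then have "p \<in> ultrafilters X \<times> ultrafilters X"
    using star_ext_subset by (metis subsetD)
  then obtain u v where p: "p = (u, v)" and u: "u \<in> ultrafilters X" and v: "v \<in> ultrafilters X"
    by (rule SigmaE)
  obtain A B where AB: "A \<in> u" "B \<in> v" "basic_clopen X A \<times> basic_clopen X B \<subseteq> W"
    using openin_beta_square_basic[OF W(1) W(2)[unfolded p]] .
  have "A \<subseteq> X" "B \<subseteq> X"
    using u v AB ultrafilter_subset by blast+
  then have "A \<times> B \<subseteq> R"
    using basic_rectangle_subset_star_ext_iff[of A X B R] W(3) AB(3) by (metis subset_trans)
  then show "p \<in> ?L"
    using not_star_ext_complement_iff[OF u v] AB(1,2) p u v by auto
qed

theorem theorem4:
  fixes X :: "'a set" and R :: "('a \<times> 'a) set"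
  assumes "R \<subseteq> X \<times> X"
  shows "star_ext X R
           = prod_topology (beta_topology X) (beta_topology X) closure_of embed_rel X R
       \<and> (ultrafilters X \<times> ultrafilters X) - star_ext X ((X \<times> X) - R)
           = prod_topology (beta_topology X) (beta_topology X) interior_of
               (prod_topology (beta_topology X) (beta_topology X) closure_of embed_rel X R)"
  using star_ext_eq_closure[OF assms] complement_star_ext_complement_eq_interior[of X R]
  by simp

end
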